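(* $UCS(SL(2,\mathbb{R}))$ contains only constant functions.
   Context: For a locally compact group $G$, $C(G)$ denotes the bounded continuous complex-valued functions on $G$. For $f\in C(G)$ and $x,y\in G$ put ${}_xf_y(z)=f(xzy)$, and let $O(f)=\{{}_xf_y: x,y\in G\}$ be the double orbit. $UCS(G)=\{f\in C(G): O(f)\text{ is equicontinuous on } G\}$. $SL(2,\mathbb{R})$ carries its usual Lie group topology. *)

theory Defs
  imports "HOL-Analysis.Analysis" "HOL-Algebra.Group"
begin

text \<open>A topological group is given by a group \<open>G\<close> and a topology \<open>T\<close> with
  \<open>topspace T = carrier G\<close>.  Functions on the group are total functions on the ambient type;
  all notions below depend only on their values on the carrier.\<close>

definition bounded_continuous_functions :: "'a topology \<Rightarrow> ('a \<Rightarrow> complex) set" where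
  "bounded_continuous_functions T =
     {f. continuous_map T euclidean f \<and> bounded (f ` topspace T)}"

definition two_sided_translate ::
    "('a, 'm) monoid_scheme \<Rightarrow> ('a \<Rightarrow> complex) \<Rightarrow> 'a \<Rightarrow> 'a \<Rightarrow> 'a \<Rightarrow> complex" where
  "two_sided_translate G f x y = (\<lambda>z. f (x \<otimes>\<^bsub>G\<^esub> z \<otimes>\<^bsub>G\<^esub> y))"

definition double_orbit ::
    "('a, 'm) monoid_scheme \<Rightarrow> ('a \<Rightarrow> complex) \<Rightarrow> ('a \<Rightarrow> complex) set" where
  "double_orbit G f = {two_sided_translate G f x y | x y. x \<in> carrier G \<and> y \<in> carrier G}"

text \<open>Equicontinuity at every point; no uniform structure on the domain is involved, so the
  neighbourhood \<open>U\<close> may depend on the point \<open>z\<close>.\<close>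

definition equicontinuous :: "'a topology \<Rightarrow> ('a \<Rightarrow> complex) set \<Rightarrow> bool" where
  "equicontinuous T F \<longleftrightarrow>
     (\<forall>z \<in> topspace T. \<forall>e > 0. \<exists>U. openin T U \<and> z \<in> U \<and>
        (\<forall>g \<in> F. \<forall>w \<in> U. dist (g w) (g z) < e))"

definition UCS :: "('a, 'm) monoid_scheme \<Rightarrow> 'a topology \<Rightarrow> ('a \<Rightarrow> complex) set" where
  "UCS G T = {f \<in> bounded_continuous_functions T. equicontinuous T (double_orbit G f)}"

definition SL2R :: "(real ^ 2 ^ 2) monoid" where
  "SL2R = \<lparr>carrier = {A. det A = 1}, mult = (**), one = mat 1\<rparr>"

text \<open>The Lie group topology of \<open>SL(2,\<real>)\<close> is the one induced from the space of
  \<open>2 \<times> 2\<close> matrices.\<close>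

definition SL2R_topology :: "(real ^ 2 ^ 2) topology" where
  "SL2R_topology = top_of_set (carrier SL2R)"

lemma topspace_SL2R_topology: "topspace SL2R_topology = carrier SL2R"
  by (simp add: SL2R_topology_def)

lemma group_SL2R: "group SL2R"
proof (rule groupI)
  fix A assume "A \<in> carrier SL2R"
  then have "det A = 1" by (simp add: SL2R_def)
  then have "invertible A" by (simp add: invertible_det_nz)
  then obtain B where B: "B ** A = mat 1" by (auto simp: invertible_def)
  then have "det B * det A = 1" by (metis det_mul det_I)
  with \<open>det A = 1\<close> B show "\<exists>B \<in> carrier SL2R. B \<otimes>\<^bsub>SL2R\<^esub> A = \<one>\<^bsub>SL2R\<^esub>"
    by (auto simp: SL2R_def)
qed (auto simp: SL2R_def det_mul matrix_mul_assoc)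

end

theory Submission
  imports Defs
begin

text \<open>Equicontinuity of the double orbit of \<open>f\<close> at the identity says that
  \<open>f (x v y)\<close> is close to \<open>f (x y)\<close> uniformly in \<open>x\<close> and \<open>y\<close> as soon as \<open>v\<close> is close to
  the identity.  With \<open>y = x\<inverse> g\<close> this compares \<open>f ((x v x\<inverse>) g)\<close> with \<open>f g\<close>, so
  \<open>f\<close> is exactly invariant under left multiplication by any element \<open>u\<close> whose conjugacy class
  accumulates at the identity (\<open>UCS_invariant\<close>).

  In \<open>SL(2,\<real>)\<close> every elementary unipotent matrix is such an element: conjugation by
  \<open>diag(k, 1/k)\<close> scales its off-diagonal entry by \<open>k\<^sup>2\<close> or \<open>k\<^sup>-\<^sup>2\<close>, hence makes it as small
  as desired.  Since the elementary matrices generate \<open>SL(2,\<real>)\<close>, the function \<open>f\<close> takes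
  everywhere the value that it has at the identity.\<close>

text \<open>Conjugacy of \<open>u\<close> to \<open>v\<close> is expressed by \<open>u x = x v\<close>, which avoids computing inverses.
  The translate of \<open>f\<close> by \<open>x\<close> on the left and \<open>x\<inverse> g\<close> on the right has the value \<open>f (u g)\<close>
  at \<open>v\<close> and \<open>f g\<close> at the identity; equicontinuity makes their distance smaller than every
  positive \<open>e\<close>.\<close>

lemma (in group) UCS_invariant:
  assumes f: "f \<in> UCS G T" and T: "topspace T = carrier G"
    and u: "u \<in> carrier G" and g: "g \<in> carrier G"
    and conj: "\<And>U. openin T U \<Longrightarrow> \<one> \<in> U \<Longrightarrow> \<exists>x \<in> carrier G. \<exists>v \<in> U. u \<otimes> x = x \<otimes> v"
  shows "f (u \<otimes> g) = f g"
proof -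
  have "dist (f (u \<otimes> g)) (f g) < e" if "e > 0" for e
  proof -
    obtain U where U: "openin T U" "\<one> \<in> U"
      and close: "\<And>h w. h \<in> double_orbit G f \<Longrightarrow> w \<in> U \<Longrightarrow> dist (h w) (h \<one>) < e"
    proof -
      have "equicontinuous T (double_orbit G f)" using f by (simp add: UCS_def)
      moreover have "\<one> \<in> topspace T" by (simp add: T)
      ultimately have "\<exists>U. openin T U \<and> \<one> \<in> U \<and>
          (\<forall>h \<in> double_orbit G f. \<forall>w \<in> U. dist (h w) (h \<one>) < e)"
        using \<open>e > 0\<close> by (simp only: equicontinuous_def)
      then show thesis using that by blast
    qed
    obtain x v where x: "x \<in> carrier G" and v: "v \<in> U" and uv: "u \<otimes> x = x \<otimes> v"
      using conj[OF U] by blast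
    define h where "h = two_sided_translate G f x (inv x \<otimes> g)"
    have "inv x \<otimes> g \<in> carrier G" using x g by simp
    then have "h \<in> double_orbit G f"
      unfolding h_def double_orbit_def using x by blast
    then have "dist (h v) (h \<one>) < e" using close v by blast
    moreover have cancel: "x \<otimes> (inv x \<otimes> g) = g"
      using x g by (simp flip: m_assoc)
    moreover have "x \<otimes> v \<otimes> (inv x \<otimes> g) = u \<otimes> g"
      using x g u by (simp add: cancel m_assoc flip: uv)
    ultimately show ?thesis using x by (simp add: h_def two_sided_translate_def)
  qed
  from this[of "dist (f (u \<otimes> g)) (f g)"] show ?thesis by auto
qed

definition mat2 :: "real \<Rightarrow> real \<Rightarrow> real \<Rightarrow> real \<Rightarrow> real ^ 2 ^ 2" where
  "mat2 a b c d = vector [vector [a, b], vector [c, d]]"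

lemma mat2_cases: obtains a b c d where "A = mat2 a b c d"
proof
  show "A = mat2 (A $ 1 $ 1) (A $ 1 $ 2) (A $ 2 $ 1) (A $ 2 $ 2)"
    by (simp add: mat2_def vec_eq_iff forall_2)
qed

lemma mat2_mult:
  "mat2 a b c d ** mat2 a' b' c' d' =
     mat2 (a * a' + b * c') (a * b' + b * d') (c * a' + d * c') (c * b' + d * d')"
  by (simp add: mat2_def vec_eq_iff forall_2 matrix_matrix_mult_def sum_2)

lemma det_mat2: "det (mat2 a b c d) = a * d - b * c"
  by (simp add: mat2_def det_2)

lemma mat2_eq_iff:
  "mat2 a b c d = mat2 a' b' c' d' \<longleftrightarrow> a = a' \<and> b = b' \<and> c = c' \<and> d = d'"
  by (auto simp: mat2_def vec_eq_iff forall_2)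

lemma mat2_in_SL2R: "mat2 a b c d \<in> carrier SL2R \<longleftrightarrow> a * d - b * c = 1"
  by (simp add: SL2R_def det_mat2)

lemma unipotent_eq_line: "mat2 1 s t 1 = mat 1 + s *\<^sub>R mat2 0 1 0 0 + t *\<^sub>R mat2 0 0 1 0"
  by (simp add: mat2_def vec_eq_iff forall_2 mat_def)

text \<open>For an off-diagonal matrix unit \<open>N\<close> the points \<open>1 + (k\<^sup>2 t) N\<close> are the conjugates of the unipotent
  \<open>1 + t N\<close> by diagonal matrices. They tend to the identity along the line as \<open>k\<close>
  tends to \<open>0\<close>.\<close>

lemma line_enters_neighbourhood:
  fixes N :: "real ^ 2 ^ 2"
  assumes "openin SL2R_topology U" and "mat 1 \<in> U"
    and SL: "\<And>s. mat 1 + s *\<^sub>R N \<in> carrier SL2R"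
  obtains k :: real where "k > 0" and "mat 1 + (k\<^sup>2 * t) *\<^sub>R N \<in> U"
proof -
  obtain S where S: "open S" "U = carrier SL2R \<inter> S"
    using assms(1) by (auto simp: SL2R_topology_def openin_open)
  have "((\<lambda>k. mat 1 + (k\<^sup>2 * t) *\<^sub>R N) \<longlongrightarrow> mat 1 + (0\<^sup>2 * t) *\<^sub>R N) (at_right 0)"
    by (intro tendsto_intros)
  then have "\<forall>\<^sub>F k in at_right 0. mat 1 + (k\<^sup>2 * t) *\<^sub>R N \<in> S"
    by (rule topological_tendstoD) (use S assms(2) in auto)
  moreover have "\<forall>\<^sub>F k in at_right 0. (k :: real) > 0"
    by (simp add: eventually_at_right_less)
  ultimately have "\<forall>\<^sub>F k in at_right 0. k > 0 \<and> mat 1 + (k\<^sup>2 * t) *\<^sub>R N \<in> S"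
    by eventually_elim simp
  then obtain k :: real where "k > 0" "mat 1 + (k\<^sup>2 * t) *\<^sub>R N \<in> S"
    using eventually_happens trivial_limit_at_right_real by blast
  with S SL that show thesis by blast
qed

text \<open>The conjugating matrix is \<open>diag(1/k, k)\<close> for the upper and \<open>diag(k, 1/k)\<close> for the
  lower unipotents; both replace the entry \<open>t\<close> by \<open>k\<^sup>2 t\<close>.\<close>

lemma UCS_SL2R_unipotent_invariant:
  assumes f: "f \<in> UCS SL2R SL2R_topology" and A: "A \<in> carrier SL2R"
  shows "f (mat2 1 t 0 1 ** A) = f A" and "f (mat2 1 0 t 1 ** A) = f A"
proof -
  have upper: "\<exists>x \<in> carrier SL2R. \<exists>v \<in> U. mat2 1 t 0 1 \<otimes>\<^bsub>SL2R\<^esub> x = x \<otimes>\<^bsub>SL2R\<^esub> v"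
    if U: "openin SL2R_topology U" "\<one>\<^bsub>SL2R\<^esub> \<in> U" for U
  proof -
    obtain k where "k > 0" and k: "mat 1 + (k\<^sup>2 * t) *\<^sub>R mat2 0 1 0 0 \<in> U"
    proof (rule line_enters_neighbourhood)
      show "mat 1 + s *\<^sub>R mat2 0 1 0 0 \<in> carrier SL2R" for s
        using unipotent_eq_line[of s 0] mat2_in_SL2R[of 1 s 0 1] by simp
    qed (use U in \<open>auto simp: SL2R_def\<close>)
    have "mat2 1 (k\<^sup>2 * t) 0 1 \<in> U"
      using k unipotent_eq_line[of "k\<^sup>2 * t" 0] by simp
    moreover have "mat2 (1/k) 0 0 k \<in> carrier SL2R"
      using \<open>k > 0\<close> by (simp add: mat2_in_SL2R)
    moreover have "mat2 1 t 0 1 ** mat2 (1/k) 0 0 k = mat2 (1/k) 0 0 k ** mat2 1 (k\<^sup>2 * t) 0 1"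
      using \<open>k > 0\<close> by (simp add: mat2_mult power2_eq_square mult.commute)
    ultimately show ?thesis by (auto simp: SL2R_def)
  qed
  have lower: "\<exists>x \<in> carrier SL2R. \<exists>v \<in> U. mat2 1 0 t 1 \<otimes>\<^bsub>SL2R\<^esub> x = x \<otimes>\<^bsub>SL2R\<^esub> v"
    if U: "openin SL2R_topology U" "\<one>\<^bsub>SL2R\<^esub> \<in> U" for U
  proof -
    obtain k where "k > 0" and k: "mat 1 + (k\<^sup>2 * t) *\<^sub>R mat2 0 0 1 0 \<in> U"
    proof (rule line_enters_neighbourhood)
      show "mat 1 + s *\<^sub>R mat2 0 0 1 0 \<in> carrier SL2R" for s
        using unipotent_eq_line[of 0 s] mat2_in_SL2R[of 1 0 s 1] by simp
    qed (use U in \<open>auto simp: SL2R_def\<close>)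
    have "mat2 1 0 (k\<^sup>2 * t) 1 \<in> U"
      using k unipotent_eq_line[of 0 "k\<^sup>2 * t"] by simp
    moreover have "mat2 k 0 0 (1/k) \<in> carrier SL2R"
      using \<open>k > 0\<close> by (simp add: mat2_in_SL2R)
    moreover have "mat2 1 0 t 1 ** mat2 k 0 0 (1/k) = mat2 k 0 0 (1/k) ** mat2 1 0 (k\<^sup>2 * t) 1"
      using \<open>k > 0\<close> by (simp add: mat2_mult power2_eq_square mult.commute)
    ultimately show ?thesis by (auto simp: SL2R_def)
  qed
  note invariant = group.UCS_invariant[OF group_SL2R f topspace_SL2R_topology _ A]
  show "f (mat2 1 t 0 1 ** A) = f A"
    using invariant[OF _ upper] mat2_in_SL2R[of 1 t 0 1] by (simp add: SL2R_def)
  show "f (mat2 1 0 t 1 ** A) = f A"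
    using invariant[OF _ lower] mat2_in_SL2R[of 1 0 t 1] by (simp add: SL2R_def)
qed

text \<open>The middle factor supplies the entry \<open>c\<close>; the outer ones are the row and the column
  operation that use \<open>c\<close> as a pivot to adjust the diagonal. The remaining entry is then
  determined by the determinant.\<close>

lemma mat2_unipotent_factorization:
  assumes "a * d - b * c = 1" and "c \<noteq> 0"
  shows "mat2 a b c d =
    mat2 1 ((a - 1) / c) 0 1 ** (mat2 1 0 c 1 ** mat2 1 ((d - 1) / c) 0 1)"
proof -
  have "b = (a * d - 1) / c" using assms by (simp add: field_simps)
  then show ?thesis using \<open>c \<noteq> 0\<close>
    by (simp add: mat2_mult mat2_eq_iff) (simp add: field_simps)
qed

theorem theorem5p3:
  shows "\<forall>f \<in> UCS SL2R SL2R_topology. f constant_on carrier SL2R"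
proof
  fix f assume f: "f \<in> UCS SL2R SL2R_topology"
  note invariant = UCS_SL2R_unipotent_invariant[OF f]
  have "f (mat2 1 t 0 1) = f (mat 1)" for t
    using invariant(1)[of "mat 1" t] by (simp add: SL2R_def)
  then have nonzero: "f (mat2 a b c d) = f (mat 1)"
    if "a * d - b * c = 1" "c \<noteq> 0" for a b c d
    unfolding mat2_unipotent_factorization[OF that]
    by (simp add: invariant SL2R_def det_mul det_mat2)
  have "f A = f (mat 1)" if A: "A \<in> carrier SL2R" for A
  proof -
    obtain a b c d where abcd: "A = mat2 a b c d" by (rule mat2_cases)
    then have det: "a * d - b * c = 1" using A by (simp add: mat2_in_SL2R)
    show ?thesis
    proof (cases "c = 0")
      case True
      \<comment> \<open>Adding the first row to the second makes the lower left entry \<open>a\<close>, which is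
        nonzero because \<open>a d = 1\<close>.\<close>
      have "f A = f (mat2 1 0 1 1 ** A)" using invariant(2)[OF A] by simp
      also have "mat2 1 0 1 1 ** A = mat2 a b a (b + d)"
        using True by (simp add: abcd mat2_mult)
      also have "f \<dots> = f (mat 1)"
        by (rule nonzero) (use det True in \<open>auto simp: algebra_simps\<close>)
      finally show ?thesis .
    next
      case False
      then show ?thesis using nonzero det abcd by simp
    qed
  qed
  then show "f constant_on carrier SL2R" unfolding constant_on_def by blast
qed

end
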